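(* There exists an algorithm which, given an instance of the constrained ranking maximization problem (U) in which every item has at most one property and whose value matrix $W$ is monotone and satisfies the Monge property, outputs an optimal ranking in $O(m+np)$ time.
   Context: An instance consists of $m$ items, $n\le m$ ranking positions, a value matrix $W\in\mathbb{R}^{m\times n}$, properties $P_1,\dots,P_p\subseteq[m]$, and upper bounds $U_{k\ell}\in\mathbb{Z}_{\ge 0}$ for $k\in[n]$, $\ell\in[p]$. A ranking is a matrix $x\in\{0,1\}^{m\times n}$ with $\sum_{i=1}^m x_{ij}=1$ for every $j\in[n]$ and $\sum_{j=1}^n x_{ij}\le 1$ for every $i\in[m]$. The problem (U) asks for a ranking maximizing $\sum_{i,j}W_{ij}x_{ij}$ subject to $\sum_{j=1}^k\sum_{i\in P_\ell}x_{ij}\le U_{k\ell}$ for all $\ell\in[p]$, $k\in[n]$. $W$ is monotone and satisfies the Monge property if for all $1\le i_1<i_2\le m$ and $1\le j_1<j_2\le n$: $W_{i_1j_1}\ge W_{i_2j_1}$, $W_{i_1j_1}\ge W_{i_1j_2}$, and $W_{i_1j_1}+W_{i_2j_2}\ge W_{i_1j_2}+W_{i_2j_1}$. *)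

theory Defs
  imports Complex_Main
begin

text \<open>
  Items, positions and properties are numbered from 0, so that \<open>[m]\<close>, \<open>[n]\<close>, \<open>[p]\<close> become
  \<open>{..<m}\<close>, \<open>{..<n}\<close>, \<open>{..<p}\<close>, and \<open>ubound I k l\<close> bounds the number of items with property \<open>l\<close>
  among the positions \<open>0, \<dots>, k\<close>.
\<close>

record ranking_instance =
  items :: nat
  positions :: nat
  properties :: nat
  weight :: "nat \<Rightarrow> nat \<Rightarrow> real"
  property :: "nat \<Rightarrow> nat set"
  ubound :: "nat \<Rightarrow> nat \<Rightarrow> nat"

definition well_formed :: "ranking_instance \<Rightarrow> bool" where
  "well_formed I \<longleftrightarrow>
     positions I \<le> items I \<and> (\<forall>l<properties I. property I l \<subseteq> {..<items I})"

definition at_most_one_property :: "ranking_instance \<Rightarrow> bool" where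
  "at_most_one_property I \<longleftrightarrow>
     (\<forall>i<items I. card {l. l < properties I \<and> i \<in> property I l} \<le> 1)"

text \<open>Each inequality is required for all the indices occurring in it; in particular,
  monotonicity includes the last row and the last column.\<close>

definition monotone_weights :: "ranking_instance \<Rightarrow> bool" where
  "monotone_weights I \<longleftrightarrow>
     (\<forall>i1 i2 j. i1 < i2 \<and> i2 < items I \<and> j < positions I \<longrightarrow>
        weight I i1 j \<ge> weight I i2 j) \<and>
     (\<forall>i j1 j2. i < items I \<and> j1 < j2 \<and> j2 < positions I \<longrightarrow>
        weight I i j1 \<ge> weight I i j2)"

definition monge :: "ranking_instance \<Rightarrow> bool" where
  "monge I \<longleftrightarrow>
     (\<forall>i1 i2 j1 j2. i1 < i2 \<and> i2 < items I \<and> j1 < j2 \<and> j2 < positions I \<longrightarrow>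
        weight I i1 j1 + weight I i2 j2 \<ge> weight I i1 j2 + weight I i2 j1)"

definition is_ranking :: "ranking_instance \<Rightarrow> (nat \<Rightarrow> nat \<Rightarrow> nat) \<Rightarrow> bool" where
  "is_ranking I x \<longleftrightarrow>
     (\<forall>i<items I. \<forall>j<positions I. x i j \<in> {0, 1}) \<and>
     (\<forall>j<positions I. (\<Sum>i<items I. x i j) = 1) \<and>
     (\<forall>i<items I. (\<Sum>j<positions I. x i j) \<le> 1)"

definition feasible :: "ranking_instance \<Rightarrow> (nat \<Rightarrow> nat \<Rightarrow> nat) \<Rightarrow> bool" where
  "feasible I x \<longleftrightarrow> is_ranking I x \<and>
     (\<forall>l<properties I. \<forall>k<positions I. (\<Sum>j\<le>k. \<Sum>i\<in>property I l. x i j) \<le> ubound I k l)"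

definition objective :: "ranking_instance \<Rightarrow> (nat \<Rightarrow> nat \<Rightarrow> nat) \<Rightarrow> real" where
  "objective I x = (\<Sum>i<items I. \<Sum>j<positions I. weight I i j * real (x i j))"

definition optimal :: "ranking_instance \<Rightarrow> (nat \<Rightarrow> nat \<Rightarrow> nat) \<Rightarrow> bool" where
  "optimal I x \<longleftrightarrow> feasible I x \<and> (\<forall>y. feasible I y \<longrightarrow> objective I y \<le> objective I x)"

text \<open>
  Algorithms are programs of a unit-cost random access machine.  The machine has registers and
  arrays for natural numbers and, separately, for real numbers.  A program mentions only finitely
  many registers and arrays, so an interleaving of the arrays turns this into the usual single
  memory at the price of a constant factor.  Every instruction and every evaluation of a test costs
  one step.  The arithmetic is restricted to addition and subtraction (truncated on the natural
  numbers), so that unit cost cannot be exploited by building up huge numbers.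
\<close>

record state =
  nreg :: "nat \<Rightarrow> nat"
  narr :: "nat \<Rightarrow> nat \<Rightarrow> nat"
  rreg :: "nat \<Rightarrow> real"
  rarr :: "nat \<Rightarrow> nat \<Rightarrow> real"

datatype instr =
    Const nat nat
  | Add nat nat nat
  | Sub nat nat nat
  | Load nat nat nat
  | Store nat nat nat
  | RAdd nat nat nat
  | RSub nat nat nat
  | RLoad nat nat nat
  | RStore nat nat nat

text \<open>In \<open>Load\<close> and \<open>Store\<close> (and their real counterparts) the operands are, in this order,
  register, array, index register and array, index register, register.\<close>

fun step :: "instr \<Rightarrow> state \<Rightarrow> state" where
  "step (Const r k) s = s\<lparr>nreg := (nreg s)(r := k)\<rparr>"
| "step (Add r a b) s = s\<lparr>nreg := (nreg s)(r := nreg s a + nreg s b)\<rparr>"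
| "step (Sub r a b) s = s\<lparr>nreg := (nreg s)(r := nreg s a - nreg s b)\<rparr>"
| "step (Load r A i) s = s\<lparr>nreg := (nreg s)(r := narr s A (nreg s i))\<rparr>"
| "step (Store A i r) s = s\<lparr>narr := (narr s)(A := (narr s A)(nreg s i := nreg s r))\<rparr>"
| "step (RAdd r a b) s = s\<lparr>rreg := (rreg s)(r := rreg s a + rreg s b)\<rparr>"
| "step (RSub r a b) s = s\<lparr>rreg := (rreg s)(r := rreg s a - rreg s b)\<rparr>"
| "step (RLoad r A i) s = s\<lparr>rreg := (rreg s)(r := rarr s A (nreg s i))\<rparr>"
| "step (RStore A i r) s = s\<lparr>rarr := (rarr s)(A := (rarr s A)(nreg s i := rreg s r))\<rparr>"

datatype test = Less nat nat | RLess nat nat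

fun holds :: "test \<Rightarrow> state \<Rightarrow> bool" where
  "holds (Less a b) s \<longleftrightarrow> nreg s a < nreg s b"
| "holds (RLess a b) s \<longleftrightarrow> rreg s a < rreg s b"

datatype program =
    Skip
  | Do instr
  | Seq program program
  | Cond test program program
  | Loop test program

text \<open>\<open>exec c s t s'\<close>: started in state \<open>s\<close>, program \<open>c\<close> halts in state \<open>s'\<close> after \<open>t\<close> steps.\<close>

inductive exec :: "program \<Rightarrow> state \<Rightarrow> nat \<Rightarrow> state \<Rightarrow> bool" where
  Skip: "exec Skip s 0 s"
| Do: "exec (Do i) s 1 (step i s)"
| Seq: "exec c s t s' \<Longrightarrow> exec d s' u s'' \<Longrightarrow> exec (Seq c d) s (t + u) s''"
| CondTrue: "holds b s \<Longrightarrow> exec c s t s' \<Longrightarrow> exec (Cond b c d) s (1 + t) s'"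
| CondFalse: "\<not> holds b s \<Longrightarrow> exec d s t s' \<Longrightarrow> exec (Cond b c d) s (1 + t) s'"
| LoopFalse: "\<not> holds b s \<Longrightarrow> exec (Loop b c) s 1 s"
| LoopTrue: "holds b s \<Longrightarrow> exec c s t s' \<Longrightarrow> exec (Loop b c) s' u s'' \<Longrightarrow>
    exec (Loop b c) s (1 + t + u) s''"

lemma exec_deterministic:
  "exec c s t s' \<Longrightarrow> exec c s u s'' \<Longrightarrow> t = u \<and> s' = s''"
proof (induction arbitrary: u s'' rule: exec.induct)
  case Skip
  then show ?case by (auto elim: exec.cases)
next
  case Do
  then show ?case by (auto elim: exec.cases)
next
  case (Seq c s t s' d v s2)
  from Seq.prems show ?case by cases (use Seq.IH in blast)
next
  case (CondTrue b s c t s' d)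
  from CondTrue.prems show ?case by cases (use CondTrue in blast)+
next
  case (CondFalse b s d t s' c)
  from CondFalse.prems show ?case by cases (use CondFalse in blast)+
next
  case (LoopFalse b s c)
  from LoopFalse.prems show ?case by cases (use LoopFalse in blast)+
next
  case (LoopTrue b s c t s' v s2)
  from LoopTrue.prems show ?case by cases (use LoopTrue in blast)+
qed

text \<open>
  Input format.  Registers 0, 1, 2 hold \<open>m\<close>, \<open>n\<close>, \<open>p\<close>.  The properties are given as lists of their
  members, in arbitrary order and stored consecutively in array 1; array 0 holds the start of each
  list.  Array 2 holds the matrix of upper bounds and real array 0 the value matrix, both row by
  row.  Nothing is assumed about the remaining memory.
\<close>

definition encodes :: "state \<Rightarrow> ranking_instance \<Rightarrow> bool" where
  "encodes s I \<longleftrightarrow>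
     nreg s 0 = items I \<and> nreg s 1 = positions I \<and> nreg s 2 = properties I \<and>
     narr s 0 0 = 0 \<and>
     (\<forall>l<properties I.
        narr s 0 (Suc l) = narr s 0 l + card (property I l) \<and>
        bij_betw (narr s 1) {narr s 0 l..<narr s 0 (Suc l)} (property I l)) \<and>
     (\<forall>k<positions I. \<forall>l<properties I. narr s 2 (k * properties I + l) = ubound I k l) \<and>
     (\<forall>i<items I. \<forall>j<positions I. rarr s 0 (i * positions I + j) = weight I i j)"

text \<open>
  Output format.  Array 3 holds, for each position, the item ranked there; this is the ranking
  matrix given by the row index of the 1 in each column (writing out all \<open>m * n\<close> entries would
  by itself exceed the time bound).
\<close>

definition output_ranking :: "state \<Rightarrow> nat \<Rightarrow> nat \<Rightarrow> nat" where
  "output_ranking s i j = (if narr s 3 j = i then 1 else 0)"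

end

theory Submission
  imports Defs
begin

text \<open>
  Fill the positions from the first to the last, each with the smallest unused item whose type
  still has room under all bounds from that position on.  Suppose that a feasible ranking agrees
  with the greedy one before position \<open>k\<close>, and let \<open>i\<close> be the greedy choice there.  Monotonicity
  and the Monge property allow \<open>i\<close> to become the first item of its type from \<open>k\<close> on without
  loss; it can then be exchanged with the item at \<open>k\<close>, because no other item of its type lies in
  between.  If no item of this type occurs from \<open>k\<close> on, \<open>i\<close> simply replaces the item at \<open>k\<close>.

  The smallest unused item of a type is the head of a sorted linked list, so after replacing the
  bounds by their suffix minima each position costs one scan over the types.
\<close>

section \<open>The exchange argument\<close>

text \<open>Disjoint properties are encoded by a type function. Only types below \<open>p\<close>
  are bounded, so an item without property gets a type outside that range.\<close>

locale typed_ranking =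
  fixes m n p :: nat
    and W :: "nat \<Rightarrow> nat \<Rightarrow> real"
    and ty :: "nat \<Rightarrow> nat"
    and U :: "nat \<Rightarrow> nat \<Rightarrow> nat"
  assumes W_antimono: "\<lbrakk>i1 < i2; i2 < m; j < n\<rbrakk> \<Longrightarrow> W i2 j \<le> W i1 j"
    and W_monge: "\<lbrakk>i1 < i2; i2 < m; j1 < j2; j2 < n\<rbrakk> \<Longrightarrow> W i1 j2 + W i2 j1 \<le> W i1 j1 + W i2 j2"
begin

definition count :: "(nat \<Rightarrow> nat) \<Rightarrow> nat \<Rightarrow> nat \<Rightarrow> nat" where
  "count f k l = card {j. j < k \<and> ty (f j) = l}"

definition admissible :: "(nat \<Rightarrow> nat) \<Rightarrow> bool" where
  "admissible f \<longleftrightarrow> (\<forall>j<n. f j < m) \<and> inj_on f {..<n} \<and>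
     (\<forall>l<p. \<forall>k<n. count f (Suc k) l \<le> U k l)"

definition profit :: "(nat \<Rightarrow> nat) \<Rightarrow> real" where
  "profit f = (\<Sum>j<n. W (f j) j)"

text \<open>The bounds need not be monotone in the position, so an item can be placed at position \<open>k\<close>
  only if all the bounds from \<open>k\<close> on leave room for it.\<close>

definition available :: "(nat \<Rightarrow> nat) \<Rightarrow> nat \<Rightarrow> nat \<Rightarrow> bool" where
  "available g k i \<longleftrightarrow> i < m \<and> i \<notin> g ` {..<k} \<and>
     (ty i < p \<longrightarrow> (\<forall>j. k \<le> j \<and> j < n \<longrightarrow> count g k (ty i) < U j (ty i)))"

text \<open>A total function stands for a partial ranking: its values from \<open>k\<close> on are
  arbitrary. Hence array 3 can play the role of \<open>g\<close> while it is still being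
  filled.\<close>

definition greedy :: "(nat \<Rightarrow> nat) \<Rightarrow> nat \<Rightarrow> bool" where
  "greedy g k \<longleftrightarrow> (\<forall>j<k. available g j (g j) \<and> (\<forall>i. available g j i \<longrightarrow> g j \<le> i))"

section \<open>Prefix counts, availability and the profit of local changes\<close>

lemma count_0 [simp]: "count f 0 l = 0"
  by (simp add: count_def)

lemma count_Suc: "count f (Suc k) l = count f k l + (if ty (f k) = l then 1 else 0)"
proof -
  have "{j. j < Suc k \<and> ty (f j) = l} =
      (if ty (f k) = l then insert k else id) {j. j < k \<and> ty (f j) = l}"
    by (auto simp: less_Suc_eq)
  then show ?thesis by (simp add: count_def)
qed

lemma count_mono: "k \<le> k' \<Longrightarrow> count f k l \<le> count f k' l"
  unfolding count_def by (rule card_mono) auto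

lemma count_cong: "(\<And>j. j < k \<Longrightarrow> ty (f j) = ty (g j)) \<Longrightarrow> count f k l = count g k l"
  unfolding count_def by (rule arg_cong[where f = card]) auto

lemma count_constant:
  assumes "k \<le> k'" and "\<And>j. k \<le> j \<Longrightarrow> j < k' \<Longrightarrow> ty (f j) \<noteq> l"
  shows "count f k' l = count f k l"
  unfolding count_def
  by (rule arg_cong[where f = card]) (use assms not_le in \<open>auto intro: less_le_trans\<close>)

lemma available_cong:
  assumes "\<And>j. j < k \<Longrightarrow> f j = g j"
  shows "available f k i \<longleftrightarrow> available g k i"
proof -
  have "count f k l = count g k l" for l
    using assms by (intro count_cong) simp
  moreover have "f ` {..<k} = g ` {..<k}"
    using assms by simp
  ultimately show ?thesis by (simp add: available_def)
qed

lemma greedy_cong: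
  assumes "\<And>j. j < k \<Longrightarrow> f j = g j"
  shows "greedy f k \<longleftrightarrow> greedy g k"
proof -
  have "available f j = available g j" "f j = g j" if "j < k" for j
    using assms that by (auto intro!: available_cong ext)
  then show ?thesis by (auto simp: greedy_def)
qed

text \<open>The item at \<open>k\<close> contributes to every prefix count from \<open>k\<close> on,
  so the count before \<open>k\<close> lies strictly below all these bounds. A least available
  choice therefore never exceeds \<open>f k\<close>.\<close>

lemma admissible_available:
  assumes "admissible f" "k < n"
  shows "available f k (f k)"
proof -
  have "f k \<notin> f ` {..<k}"
    using assms by (fastforce simp: admissible_def inj_on_def)
  moreover have "count f k (ty (f k)) < U j (ty (f k))"
    if "ty (f k) < p" "k \<le> j" "j < n" for j
  proof -
    have "Suc (count f k (ty (f k))) = count f (Suc k) (ty (f k))"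
      by (simp add: count_Suc)
    also have "\<dots> \<le> count f (Suc j) (ty (f k))"
      using that by (intro count_mono) simp
    also have "\<dots> \<le> U j (ty (f k))"
      using assms that by (auto simp: admissible_def)
    finally show ?thesis by simp
  qed
  ultimately show ?thesis
    using assms by (auto simp: available_def admissible_def)
qed

lemma available_same_type:
  "\<lbrakk>available f k i; ty i' = ty i; i' < m; i' \<notin> f ` {..<k}\<rbrakk> \<Longrightarrow> available f k i'"
  by (simp add: available_def)

lemma profit_replace:
  assumes "i \<le> f j" "j < n" "f j < m"
  shows "profit f \<le> profit (f(j := i))"
  unfolding profit_def
  by (rule sum_mono) (use assms W_antimono in \<open>auto simp: le_less\<close>)

text \<open>Moving the smaller item to the earlier position is the Monge inequality for rows
  \<open>f b\<close>, \<open>f a\<close> and columns \<open>a\<close>, \<open>b\<close>; the other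
  positions keep their items.\<close>

lemma profit_swap:
  assumes "a < b" "b < n" "f b \<le> f a" "f a < m"
  shows "profit f \<le> profit (f(a := f b, b := f a))"
proof -
  let ?g = "f(a := f b, b := f a)"
  have split: "(\<Sum>j<n. h j) = h a + h b + (\<Sum>j\<in>{..<n} - {a} - {b}. h j)" for h :: "nat \<Rightarrow> real"
    using assms sum.remove[of "{..<n}" a h] sum.remove[of "{..<n} - {a}" b h] by simp
  have "W (f a) a + W (f b) b \<le> W (f b) a + W (f a) b"
    using assms W_monge[of "f b" "f a" a b] by (cases "f a = f b") auto
  moreover have "(\<Sum>j\<in>{..<n} - {a} - {b}. W (?g j) j) = (\<Sum>j\<in>{..<n} - {a} - {b}. W (f j) j)"
    by (rule sum.cong) auto
  ultimately show ?thesis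
    using assms unfolding profit_def split by simp
qed

text \<open>The transposition of \<open>a\<close> and \<open>b\<close> permutes the positions below
  \<open>k\<close> and maps one counted set bijectively onto the other.\<close>

lemma count_swap:
  assumes "a < k" "b < k"
  shows "count (f(a := f b, b := f a)) k l = count f k l"
proof -
  let ?s = "id(a := b, b := a)"
  have "{j. j < k \<and> ty ((f(a := f b, b := f a)) j) = l} = ?s ` {j. j < k \<and> ty (f j) = l}"
    using assms by (auto simp: image_iff split: if_splits)
  moreover have "inj ?s" by (auto simp: inj_def)
  then have "card (?s ` {j. j < k \<and> ty (f j) = l}) = card {j. j < k \<and> ty (f j) = l}"
    by (intro card_image) (rule inj_on_subset, auto)
  ultimately show ?thesis
    unfolding count_def by (simp only:)
qed

lemma inj_on_swap:
  "\<lbrakk>inj_on f A; a \<in> A; b \<in> A\<rbrakk> \<Longrightarrow> inj_on (f(a := f b, b := f a)) A"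
  by (auto simp: inj_on_def)

lemma exchange:
  assumes g: "greedy g (Suc k)" and "k < n" and f: "admissible f"
    and agree: "\<And>j. j < k \<Longrightarrow> f j = g j"
  shows "\<exists>f'. admissible f' \<and> (\<forall>j<Suc k. f' j = g j) \<and> profit f \<le> profit f'"
proof -
  define i where "i = g k"
  define l where "l = ty i"
  have least: "i \<le> x" if "available f k x" for x
    using g that available_cong[OF agree] by (auto simp: greedy_def i_def)
  have avail: "available f k i"
    using g available_cong[OF agree] by (auto simp: greedy_def i_def)
  then have i: "i < m" "i \<notin> f ` {..<k}"
    by (auto simp: available_def)
  have room: "count f k l < U j l" if "l < p" "k \<le> j" "j < n" for j
    using avail that by (auto simp: available_def l_def)
  have fm: "f j < m" if "j < n" for j
    using f that by (auto simp: admissible_def)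
  have inj: "inj_on f {..<n}"
    using f by (auto simp: admissible_def)
  have bound: "count f (Suc j) t \<le> U j t" if "t < p" "j < n" for t j
    using f that by (auto simp: admissible_def)
  show ?thesis
  proof (cases "\<exists>j. k \<le> j \<and> j < n \<and> ty (f j) = l")
    case False
    let ?f = "f(k := i)"
    have new: "i \<notin> f ` {..<n}"
      using i False by (auto simp: l_def)
    \<comment> \<open>Only the count of type \<open>l\<close> in prefixes containing
      \<open>k\<close> can grow. No further item of this type follows, so it stays at
      \<open>count f k l + 1\<close>, which \<open>room\<close> permits.\<close>
    have "count ?f (Suc j) t \<le> U j t" if "t < p" "j < n" for t j
    proof (cases "t = l \<and> k \<le> j")
      case True
      have "count ?f (Suc j) l = count ?f (Suc k) l"
        using True False \<open>j < n\<close> by (intro count_constant) auto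
      also have "\<dots> = Suc (count f k l)"
        using count_cong[of k ?f f l] by (simp add: count_Suc l_def)
      finally show ?thesis using room[of j] True that by simp
    next
      case no: False
      have "count ?f (Suc j) t \<le> count f (Suc j) t"
        unfolding count_def by (rule card_mono) (use no in \<open>auto simp: l_def\<close>)
      then show ?thesis using bound[OF that] by simp
    qed
    moreover have "inj_on ?f {..<n}"
      using inj new by (auto simp: inj_on_def)
    ultimately have "admissible ?f"
      using fm i by (auto simp: admissible_def)
    moreover have "profit f \<le> profit ?f"
      using least admissible_available[OF f] fm \<open>k < n\<close> by (intro profit_replace) auto
    ultimately show ?thesis
      using agree by (intro exI[of _ ?f]) (auto simp: i_def less_Suc_eq)
  next
    case True
    define j where "j = (LEAST j. k \<le> j \<and> j < n \<and> ty (f j) = l)"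
    have j: "k \<le> j" "j < n" "ty (f j) = l"
      using LeastI_ex[OF True] by (auto simp: j_def)
    have before: "ty (f x) \<noteq> l" if "k \<le> x" "x < j" for x
      using not_less_Least[of x "\<lambda>j. k \<le> j \<and> j < n \<and> ty (f j) = l"] that j
      by (auto simp: j_def)
    have ij: "i \<le> f j"
      by (rule least, rule available_same_type[OF avail])
        (use j fm inj in \<open>auto simp: l_def dest: inj_onD\<close>)
    text \<open>Exchanging items of the same type does not affect the constraints, so \<open>i\<close> can be taken
      to be the first item of its type from position \<open>k\<close> on.\<close>
    obtain h where h: "h j = i" "\<And>x. x < n \<Longrightarrow> h x < m" "inj_on h {..<n}"
      "\<And>x. x < n \<Longrightarrow> ty (h x) = ty (f x)" "\<And>x. x < k \<Longrightarrow> h x = f x" "profit f \<le> profit h"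
    proof (cases "i \<in> f ` {..<n}")
      case True
      then obtain b where b: "b < n" "f b = i" by auto
      have "k \<le> b" using b i by (metis imageI lessThan_iff not_le)
      with b before have "j \<le> b" by (metis l_def not_le)
      let ?h = "f(j := f b, b := f j)"
      have "profit f \<le> profit ?h"
      proof (cases "j = b")
        case False
        with \<open>j \<le> b\<close> show ?thesis
          using b ij j fm by (intro profit_swap) auto
      qed simp
      then show ?thesis
        using b j fm inj \<open>k \<le> b\<close>
        by (intro that[of ?h] inj_on_swap) (auto simp: l_def)
    next
      case False
      let ?h = "f(j := i)"
      have "inj_on ?h {..<n}"
        using inj False by (auto simp: inj_on_def)
      moreover have "profit f \<le> profit ?h"
        using ij j fm by (intro profit_replace) auto
      ultimately show ?thesis
        using j fm i by (intro that[of ?h]) (auto simp: l_def)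
    qed
    have hcount: "count h x t = count f x t" if "x \<le> n" for x t
      using h(4) that by (intro count_cong) auto
    have adm: "admissible h"
      using h(2,3) bound by (auto simp: admissible_def hcount)
    show ?thesis
    proof (cases "j = k")
      case True
      then show ?thesis
        using adm h agree by (intro exI[of _ h]) (auto simp: i_def less_Suc_eq)
    next
      case False
      with j have "k < j" by simp
      \<comment> \<open>The item \<open>i\<close> moves forward from \<open>j\<close> to
        \<open>k\<close>, and the item it displaces goes to \<open>j\<close>.\<close>
      let ?f = "h(k := h j, j := h k)"
      have "count ?f (Suc x) t \<le> U x t" if "t < p" "x < n" for t x
      proof -
        \<comment> \<open>Prefixes reaching \<open>j\<close> contain both swapped positions. In
          prefixes ending in between, \<open>i\<close> is the only item of type \<open>l\<close>
          from \<open>k\<close> on. All remaining counts are unchanged or drop.\<close>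
        consider "j \<le> x" | "x < j" "t = l" "k \<le> x" | "x < j" "t \<noteq> l \<or> x < k"
          by linarith
        then show ?thesis
        proof cases
          case 1
          then show ?thesis
            using count_swap[of k "Suc x" j h t] hcount bound that \<open>k < j\<close> by simp
        next
          case 2
          have "count ?f (Suc x) l = count ?f (Suc k) l"
            using 2 before h(4) \<open>x < n\<close> by (intro count_constant) auto
          also have "\<dots> = Suc (count h k l)"
            using count_cong[of k ?f h l] \<open>k < j\<close> by (simp add: count_Suc l_def h(1))
          finally show ?thesis
            using room[of x] 2 that hcount[of k l] \<open>k < n\<close> by simp
        next
          case 3
          have "count ?f (Suc x) t \<le> count h (Suc x) t"
            unfolding count_def by (rule card_mono) (use 3 in \<open>auto simp: l_def h(1)\<close>)
          then show ?thesis using hcount bound that by (metis Suc_leI le_trans)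
        qed
      qed
      moreover have "inj_on ?f {..<n}"
        using h(3) j \<open>k < n\<close> by (intro inj_on_swap) auto
      ultimately have "admissible ?f"
        using h(2) j \<open>k < n\<close> by (auto simp: admissible_def)
      \<comment> \<open>Since \<open>h\<close> is admissible and agrees with \<open>f\<close> before
        \<open>k\<close>, its own item at \<open>k\<close> is available there, so the swap puts the
        smaller item first.\<close>
      moreover have "i \<le> h k"
        using admissible_available[OF adm \<open>k < n\<close>] available_cong[OF h(5)] least by auto
      then have "profit h \<le> profit ?f"
        using \<open>k < j\<close> j h(1,2) \<open>k < n\<close> by (intro profit_swap) auto
      ultimately show ?thesis
        using h agree \<open>k < j\<close> by (intro exI[of _ ?f]) (auto simp: i_def less_Suc_eq)
    qed
  qed
qed

section \<open>Optimality of the greedy ranking\<close>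

lemma greedy_dominates_prefix:
  assumes "greedy g k" "k \<le> n" "admissible f"
  shows "\<exists>f'. admissible f' \<and> (\<forall>j<k. f' j = g j) \<and> profit f \<le> profit f'"
  using assms
proof (induction k)
  case 0
  then show ?case by auto
next
  case (Suc k)
  then have "greedy g k" by (auto simp: greedy_def)
  with Suc obtain f' where "admissible f'" "\<forall>j<k. f' j = g j" "profit f \<le> profit f'"
    by auto
  with exchange[OF Suc.prems(1), of f'] Suc.prems show ?case
    by (meson Suc_le_lessD order_trans)
qed

text \<open>Once all \<open>n\<close> positions agree, the transformed ranking differs from
  \<open>g\<close> at most outside \<open>{..<n}\<close>, where neither admissibility nor profit
  looks.\<close>

lemma greedy_optimal:
  assumes "greedy g n" "admissible f"
  shows "admissible g" "profit f \<le> profit g"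
proof -
  obtain f' where f': "admissible f'" "\<forall>j<n. f' j = g j" "profit f \<le> profit f'"
    using greedy_dominates_prefix[OF assms(1) _ assms(2)] by auto
  have "inj_on g {..<n}"
    using f' inj_on_cong[of "{..<n}" f' g] by (auto simp: admissible_def)
  moreover have "count f' (Suc k) l = count g (Suc k) l" if "k < n" for k l
    using f'(2) that by (intro count_cong) auto
  ultimately show "admissible g"
    using f'(1,2) by (auto simp: admissible_def)
  have "profit f' = profit g"
    using f'(2) by (simp add: profit_def)
  with f'(3) show "profit f \<le> profit g" by simp
qed

text \<open>An admissible ranking can be transformed to agree with the greedy prefix; its item at
  \<open>k\<close> is then available. So the greedy procedure gets stuck only on infeasible
  instances.\<close>

lemma greedy_continues:
  assumes "greedy g k" "k < n" "admissible f"
  shows "\<exists>i. available g k i"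
proof -
  obtain f' where "admissible f'" "\<forall>j<k. f' j = g j"
    using greedy_dominates_prefix[OF assms(1) _ assms(3)] assms(2) by auto
  then show ?thesis
    using admissible_available[of f' k] available_cong[of k f' g] assms(2) by blast
qed

end


section \<open>Timed execution\<close>

text \<open>A total-correctness statement with an upper bound on the steps. Execution is
  deterministic, so asking for some halting run loses nothing.\<close>

definition runs :: "program \<Rightarrow> state \<Rightarrow> nat \<Rightarrow> (state \<Rightarrow> bool) \<Rightarrow> bool" where
  "runs c s T Q \<longleftrightarrow> (\<exists>t s'. exec c s t s' \<and> t \<le> T \<and> Q s')"

lemma runs_mono:
  "\<lbrakk>runs c s T Q; T \<le> T'; \<And>s'. Q s' \<Longrightarrow> Q' s'\<rbrakk> \<Longrightarrow> runs c s T' Q'"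
  unfolding runs_def by (meson le_trans)

lemma runs_Skip: "Q s \<Longrightarrow> runs Skip s T Q"
  unfolding runs_def by (blast intro: exec.Skip)

lemma runs_Seq:
  assumes "runs c s T Q'" "\<And>s'. Q' s' \<Longrightarrow> runs d s' T' Q" "T + T' \<le> T''"
  shows "runs (Seq c d) s T'' Q"
proof -
  obtain t s' where "exec c s t s'" "t \<le> T" "Q' s'"
    using assms(1) by (auto simp: runs_def)
  moreover from this obtain u s'' where "exec d s' u s''" "u \<le> T'" "Q s''"
    using assms(2) unfolding runs_def by blast
  ultimately show ?thesis
    using assms(3) unfolding runs_def
    by (intro exI[of _ "t + u"] exI[of _ s'']) (auto intro: exec.Seq)
qed

lemma runs_Cond:
  assumes "holds b s \<Longrightarrow> runs c s T Q" "\<not> holds b s \<Longrightarrow> runs d s T Q" "Suc T \<le> T'"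
  shows "runs (Cond b c d) s T' Q"
proof -
  obtain e t s' where "e = (if holds b s then c else d)" "exec e s t s'" "t \<le> T" "Q s'"
    using assms(1,2) unfolding runs_def by (cases "holds b s") (simp, blast)+
  then show ?thesis
    using assms(3) unfolding runs_def
    by (intro exI[of _ "1 + t"] exI[of _ s'])
      (auto split: if_splits intro: exec.CondTrue[simplified] exec.CondFalse[simplified])
qed

text \<open>The index \<open>k\<close> counts completed iterations. The cost \<open>T k\<close> may
  vary with it, so that a nested loop can be charged by the lengths of the lists it visits; the
  final 1 pays for the failing test.\<close>

lemma runs_Loop:
  assumes "J 0 s"
    and "\<And>k s. \<lbrakk>k < N; J k s\<rbrakk> \<Longrightarrow> holds b s \<and> runs c s (T k) (J (Suc k))"
    and "\<And>s. J N s \<Longrightarrow> \<not> holds b s"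
    and "(\<Sum>k<N. Suc (T k)) + 1 \<le> T'"
  shows "runs (Loop b c) s T' (J N)"
proof -
  \<comment> \<open>Induction downwards from \<open>N\<close>, on the cost that remains after
    \<open>k\<close> iterations.\<close>
  have "runs (Loop b c) s ((\<Sum>i=k..<N. Suc (T i)) + 1) (J N)" if "k \<le> N" "J k s" for k s
    using that
  proof (induction arbitrary: s rule: inc_induct)
    case base
    then show ?case
      using assms(3) unfolding runs_def by (auto intro!: exI exec.LoopFalse)
  next
    case (step k)
    then obtain t s' where s': "holds b s" "exec c s t s'" "t \<le> T k" "J (Suc k) s'"
      using assms(2)[of k s] unfolding runs_def by blast
    with step.IH obtain u s'' where "exec (Loop b c) s' u s''"
      "u \<le> (\<Sum>i=Suc k..<N. Suc (T i)) + 1" "J N s''"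
      unfolding runs_def by blast
    with s' show ?case
      using step.hyps unfolding runs_def
      by (intro exI[of _ "1 + t + u"] exI[of _ s''])
        (auto intro: exec.LoopTrue[simplified] simp: sum.atLeast_Suc_lessThan)
  qed
  from this[of 0 s] assms(1) show ?thesis
    by (auto intro: runs_mono[OF _ assms(4)] simp: atLeast0LessThan)
qed

fun block :: "instr list \<Rightarrow> program" where
  "block [] = Skip"
| "block (i # is) = Seq (Do i) (block is)"

declare block.simps [simp del]

text \<open>Straight-line code is reduced to \<open>fold step\<close>, which the simplifier
  evaluates on a concrete instruction list.\<close>

lemma runs_block: "\<lbrakk>length is \<le> T; Q (fold step is s)\<rbrakk> \<Longrightarrow> runs (block is) s T Q"
proof (induction "is" arbitrary: s T)
  case Nil
  then show ?case by (simp add: block.simps runs_Skip)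
next
  case (Cons i "is")
  have "runs (Do i) s 1 (\<lambda>s'. s' = step i s)"
    unfolding runs_def by (blast intro: exec.Do)
  then show ?case
    unfolding block.simps
    by (rule runs_Seq[where T' = "length is"]) (use Cons in auto)
qed

lemma runs_block_Seq:
  "\<lbrakk>runs d (fold step is s) T Q; length is + T \<le> T'\<rbrakk> \<Longrightarrow> runs (Seq (block is) d) s T' Q"
  by (rule runs_Seq[where T = "length is" and Q' = "\<lambda>s'. s' = fold step is s"])
    (auto intro: runs_block)

lemma runs_for:
  assumes "J 0 (fold step is s)"
    and "\<And>k s. \<lbrakk>k < N; J k s\<rbrakk> \<Longrightarrow> holds b s \<and> runs c s (T k) (J (Suc k))"
    and "\<And>s. J N s \<Longrightarrow> \<not> holds b s \<and> Q s"
    and "length is + (\<Sum>k<N. Suc (T k)) + 1 \<le> T'"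
  shows "runs (Seq (block is) (Loop b c)) s T' Q"
proof (rule runs_Seq)
  show "runs (block is) s (length is) (J 0)"
    using assms(1) by (intro runs_block) auto
next
  fix s1 assume "J 0 s1"
  then have "runs (Loop b c) s1 ((\<Sum>k<N. Suc (T k)) + 1) (J N)"
    by (rule runs_Loop[where J = J and T = T]) (use assms in auto)
  then show "runs (Loop b c) s1 ((\<Sum>k<N. Suc (T k)) + 1) Q"
    by (rule runs_mono) (use assms(3) in auto)
qed (use assms(4) in simp)


section \<open>The program\<close>

text \<open>Registers 3 and 4 hold the constants 0 and 1.  An item without property gets type \<open>p\<close>.
  Array 4 holds the types of the items, array 6 the first unused item of each type (\<open>m\<close> if there is
  none), array 5 the next item of the same type (or \<open>m\<close>), and array 7 the number of items of each
  type ranked so far.\<close>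

definition fixed_regs :: "nat \<Rightarrow> nat \<Rightarrow> nat \<Rightarrow> state \<Rightarrow> bool" where
  "fixed_regs m n p s \<longleftrightarrow>
     nreg s 0 = m \<and> nreg s 1 = n \<and> nreg s 2 = p \<and> nreg s 3 = 0 \<and> nreg s 4 = 1"

section \<open>Computing the type of each item\<close>

definition clear_types :: program where
  "clear_types = Seq (block [Const 5 0])
     (Loop (Less 5 0) (block [Store 4 5 2, Add 5 5 4]))"

text \<open>The equation for \<open>narr s'\<close> doubles as a frame condition: every array except
  array 4 is preserved. Later phases use the same form.\<close>

lemma runs_clear_types:
  assumes "fixed_regs m n p s"
  shows "runs clear_types s (3 * m + 2)
    (\<lambda>s'. fixed_regs m n p s' \<and> (\<exists>A. narr s' = (narr s)(4 := A) \<and> (\<forall>i<m. A i = p)))"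
  unfolding clear_types_def
proof (rule runs_for[where N = m and T = "\<lambda>_. 2" and J = "\<lambda>k s'. fixed_regs m n p s' \<and> nreg s' 5 = k \<and>
    (\<exists>A. narr s' = (narr s)(4 := A) \<and> (\<forall>i<k. A i = p))"], goal_cases)
  case 1
  then show ?case
    using assms by (auto simp: fixed_regs_def intro!: exI[of _ "narr s 4"])
next
  case (2 k s1)
  then obtain A where "narr s1 = (narr s)(4 := A)" "\<forall>i<k. A i = p"
    by auto
  with 2 show ?case
    by (intro conjI runs_block) (auto simp: fixed_regs_def less_Suc_eq intro!: exI[of _ "A(k := p)"])
qed (auto simp: fixed_regs_def)

definition mark_property :: program where
  "mark_property = Loop (Less 6 7) (block [Load 8 1 6, Store 4 8 5, Add 6 6 4])"

lemma runs_mark_property: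
  assumes "fixed_regs m n p s" "nreg s 6 \<le> nreg s 7"
  shows "runs mark_property s (4 * (nreg s 7 - nreg s 6) + 1)
    (\<lambda>s'. fixed_regs m n p s' \<and> nreg s' 5 = nreg s 5 \<and> nreg s' 6 = nreg s 7 \<and>
      narr s' = (narr s)(4 := \<lambda>i. if i \<in> narr s 1 ` {nreg s 6..<nreg s 7} then nreg s 5
                                  else narr s 4 i))"
proof -
  let ?J = "\<lambda>k s'. fixed_regs m n p s' \<and> nreg s' 5 = nreg s 5 \<and> nreg s' 6 = nreg s 6 + k \<and>
      nreg s' 7 = nreg s 7 \<and>
      narr s' = (narr s)(4 := \<lambda>i. if i \<in> narr s 1 ` {nreg s 6..<nreg s 6 + k} then nreg s 5
                                  else narr s 4 i)"
  have "runs mark_property s (4 * (nreg s 7 - nreg s 6) + 1) (?J (nreg s 7 - nreg s 6))"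
    unfolding mark_property_def
  proof (rule runs_Loop[where J = ?J and T = "\<lambda>_. 3"], goal_cases)
    case (2 k s1)
    then show ?case
      by (intro conjI runs_block) (auto simp: fixed_regs_def atLeastLessThanSuc fun_eq_iff)
  qed (use assms in \<open>auto simp: fixed_regs_def\<close>)
  then show ?thesis
    by (rule runs_mono) (use assms in auto)
qed

text \<open>The lists are stored consecutively, so register 6, left at the end of one list, already
  is the start of the next; only list ends are loaded.\<close>

definition mark_types :: program where
  "mark_types = Seq (block [Const 5 0, Const 6 0]) (Loop (Less 5 2)
     (Seq (block [Add 9 5 4, Load 7 0 9]) (Seq mark_property (block [Add 5 5 4]))))"

text \<open>A list costs time linear in its length plus a constant. Since the properties are
  disjoint subsets of the items, the lengths add up to at most \<open>m\<close>.\<close>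

lemma runs_mark_types:
  assumes "fixed_regs m n p s" and start: "narr s 0 0 = 0"
    and step: "\<And>l. l < p \<Longrightarrow> narr s 0 (Suc l) = narr s 0 l + card (P l)"
    and members: "\<And>l. l < p \<Longrightarrow> narr s 1 ` {narr s 0 l..<narr s 0 (Suc l)} = P l"
    and disjoint: "\<And>l l'. \<lbrakk>l < p; l' < p; l \<noteq> l'\<rbrakk> \<Longrightarrow> P l \<inter> P l' = {}"
    and subset: "\<And>l. l < p \<Longrightarrow> P l \<subseteq> {..<m}"
    and clear: "\<And>i. i < m \<Longrightarrow> narr s 4 i = p"
  shows "runs mark_types s (4 * m + 5 * p + 3)
    (\<lambda>s'. fixed_regs m n p s' \<and> (\<exists>A. narr s' = (narr s)(4 := A) \<and>
       (\<forall>i<m. A i \<le> p \<and> (\<forall>l<p. A i = l \<longleftrightarrow> i \<in> P l))))"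
  unfolding mark_types_def
proof (rule runs_for[where N = p and T = "\<lambda>l. 4 * card (P l) + 4" and J = "\<lambda>k s'. fixed_regs m n p s' \<and>
    nreg s' 5 = k \<and> nreg s' 6 = narr s 0 k \<and> (\<exists>A. narr s' = (narr s)(4 := A) \<and>
      (\<forall>i<m. if \<exists>l<k. i \<in> P l then A i < k \<and> i \<in> P (A i) else A i = p))"], goal_cases)
  case 1
  then show ?case
    using assms by (auto simp: fixed_regs_def intro!: exI[of _ "narr s 4"])
next
  case (2 k s1)
  then obtain A where s1: "fixed_regs m n p s1" "nreg s1 5 = k" "nreg s1 6 = narr s 0 k"
    and A: "narr s1 = (narr s)(4 := A)"
      "\<And>i. i < m \<Longrightarrow> if \<exists>l<k. i \<in> P l then A i < k \<and> i \<in> P (A i) else A i = p"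
    by auto
  define s2 where "s2 = fold step [Add 9 5 4, Load 7 0 9] s1"
  have s2: "fixed_regs m n p s2" "nreg s2 5 = k" "nreg s2 6 = narr s 0 k"
    "nreg s2 7 = narr s 0 (Suc k)" "narr s2 = (narr s)(4 := A)"
    using s1 A by (auto simp: fixed_regs_def s2_def)
  let ?B = "\<lambda>i. if i \<in> P k then k else A i"
  have B: "if \<exists>l<Suc k. i \<in> P l then ?B i < Suc k \<and> i \<in> P (?B i) else ?B i = p" if "i < m" for i
    using A(2)[OF that] by (auto simp: less_Suc_eq split: if_splits)
  have "runs mark_property s2 (4 * card (P k) + 1)
    (\<lambda>s'. fixed_regs m n p s' \<and> nreg s' 5 = k \<and> nreg s' 6 = narr s 0 (Suc k) \<and>
      narr s' = (narr s)(4 := ?B))"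
    by (rule runs_mono[OF runs_mark_property[of m n p]])
      (use s2 step[OF \<open>k < p\<close>] members[OF \<open>k < p\<close>] in \<open>auto cong: if_cong\<close>)
  then have "runs (Seq mark_property (block [Add 5 5 4])) s2 (4 * card (P k) + 2)
    (\<lambda>s'. fixed_regs m n p s' \<and> nreg s' 5 = Suc k \<and> nreg s' 6 = narr s 0 (Suc k) \<and>
      narr s' = (narr s)(4 := ?B))"
    by (rule runs_Seq[where T' = 1]) (auto simp: fixed_regs_def intro!: runs_block)
  then have "runs (Seq mark_property (block [Add 5 5 4])) s2 (4 * card (P k) + 2)
    (\<lambda>s'. fixed_regs m n p s' \<and> nreg s' 5 = Suc k \<and> nreg s' 6 = narr s 0 (Suc k) \<and>
      (\<exists>A. narr s' = (narr s)(4 := A) \<and> (\<forall>i<m. if \<exists>l<Suc k. i \<in> P l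
        then A i < Suc k \<and> i \<in> P (A i) else A i = p)))"
    by (rule runs_mono) (use B in blast)+
  then show ?case
    using s1 2(1) unfolding s2_def
    by (intro conjI runs_block_Seq) (auto simp: fixed_regs_def)
next
  case (3 s1)
  then obtain A where A: "narr s1 = (narr s)(4 := A)"
      "\<And>i. i < m \<Longrightarrow> if \<exists>l<p. i \<in> P l then A i < p \<and> i \<in> P (A i) else A i = p"
    by auto
  \<comment> \<open>The invariant only says that \<open>A i\<close> is some property containing
    \<open>i\<close>, if there is one; disjointness makes it the only one.\<close>
  have "A i \<le> p \<and> (\<forall>l<p. A i = l \<longleftrightarrow> i \<in> P l)" if "i < m" for i
    using A(2)[OF that] disjoint[of "A i"] by (auto split: if_splits)
  with 3 A(1) show ?case by (auto simp: fixed_regs_def)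
next
  case 4
  have "finite (P l)" if "l < p" for l
    using finite_subset[OF subset[OF that]] by simp
  then have "(\<Sum>l<p. card (P l)) = card (\<Union>l<p. P l)"
    using disjoint by (intro card_UN_disjoint[symmetric]) auto
  also have "\<dots> \<le> card {..<m}"
    using subset by (intro card_mono) auto
  finally show ?case
    by (simp add: sum.distrib flip: sum_distrib_left)
qed

section \<open>Sorted linked lists of the items of each type\<close>

definition init_heads :: program where
  "init_heads = Seq (block [Const 5 0, Add 6 2 4])
     (Loop (Less 5 6) (block [Store 6 5 0, Store 7 5 3, Add 5 5 4]))"

text \<open>There are \<open>Suc p\<close> entries because the items without property, of type
  \<open>p\<close>, have a list and a counter too.\<close>

lemma runs_init_heads:
  assumes "fixed_regs m n p s"
  shows "runs init_heads s (4 * p + 7) (\<lambda>s'. fixed_regs m n p s' \<and>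
    (\<exists>H C. narr s' = (narr s)(6 := H, 7 := C) \<and> (\<forall>l\<le>p. H l = m \<and> C l = 0)))"
  unfolding init_heads_def
proof (rule runs_for[where N = "Suc p" and T = "\<lambda>_. 3" and J = "\<lambda>k s'. fixed_regs m n p s' \<and>
    nreg s' 5 = k \<and> nreg s' 6 = Suc p \<and>
    (\<exists>H C. narr s' = (narr s)(6 := H, 7 := C) \<and> (\<forall>l<k. H l = m \<and> C l = 0))"], goal_cases)
  case 1
  then show ?case
    using assms by (auto simp: fixed_regs_def intro!: exI[of _ "narr s _"])
next
  case (2 k s1)
  then obtain H C where s1: "fixed_regs m n p s1" "nreg s1 5 = k" "nreg s1 6 = Suc p"
      "narr s1 = (narr s)(6 := H, 7 := C)" and "\<forall>l<k. H l = m \<and> C l = 0"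
    by auto
  then have HC: "\<forall>l<Suc k. (H(k := m)) l = m \<and> (C(k := 0)) l = 0"
    by (simp add: less_Suc_eq)
  have "runs (block [Store 6 5 0, Store 7 5 3, Add 5 5 4]) s1 3 (\<lambda>s'. fixed_regs m n p s' \<and>
      nreg s' 5 = Suc k \<and> nreg s' 6 = Suc p \<and> narr s' = (narr s)(6 := H(k := m), 7 := C(k := 0)))"
    using s1 by (intro runs_block) (auto simp: fixed_regs_def fun_upd_twist)
  then have "runs (block [Store 6 5 0, Store 7 5 3, Add 5 5 4]) s1 3 (\<lambda>s'. fixed_regs m n p s' \<and>
      nreg s' 5 = Suc k \<and> nreg s' 6 = Suc p \<and>
      (\<exists>H C. narr s' = (narr s)(6 := H, 7 := C) \<and> (\<forall>l<Suc k. H l = m \<and> C l = 0)))"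
    by (rule runs_mono) (use HC in blast)+
  with s1 2(1) show ?case by simp
qed (auto simp: fixed_regs_def less_Suc_eq_le)

text \<open>The value \<open>m\<close> marks the end of a list. It exceeds every item, so
  comparisons of heads need no special case for empty lists.\<close>

definition first_item :: "(nat \<Rightarrow> nat) \<Rightarrow> nat \<Rightarrow> nat \<Rightarrow> nat \<Rightarrow> nat \<Rightarrow> bool" where
  "first_item ty m l a h \<longleftrightarrow>
     a \<le> h \<and> h \<le> m \<and> (h < m \<longrightarrow> ty h = l) \<and> (\<forall>i. a \<le> i \<and> i < h \<longrightarrow> ty i \<noteq> l)"

text \<open>Items are pushed onto the front of their lists from the last item to the first, which
  leaves every list increasing without sorting.\<close>

definition link :: program where
  "link = Seq (block [Add 5 0 3]) (Loop (Less 3 5)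
     (block [Sub 5 5 4, Load 6 4 5, Load 7 6 6, Store 5 5 7, Store 6 6 5]))"

lemma runs_link:
  assumes "fixed_regs m n p s" and types: "narr s 4 = ty" "\<And>i. i < m \<Longrightarrow> ty i \<le> p"
    and heads: "\<And>l. l \<le> p \<Longrightarrow> narr s 6 l = m"
  shows "runs link s (6 * m + 2) (\<lambda>s'. fixed_regs m n p s' \<and>
    (\<exists>N H. narr s' = (narr s)(5 := N, 6 := H) \<and>
      (\<forall>i<m. first_item ty m (ty i) (Suc i) (N i)) \<and> (\<forall>l\<le>p. first_item ty m l 0 (H l))))"
  unfolding link_def
proof (rule runs_for[where N = m and T = "\<lambda>_. 5" and J = "\<lambda>k s'. fixed_regs m n p s' \<and>
    k \<le> m \<and> nreg s' 5 = m - k \<and> (\<exists>N H. narr s' = (narr s)(5 := N, 6 := H) \<and>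
      (\<forall>i<m. m - k \<le> i \<longrightarrow> first_item ty m (ty i) (Suc i) (N i)) \<and>
      (\<forall>l\<le>p. first_item ty m l (m - k) (H l)))"], goal_cases)
  case 1
  then show ?case
    using assms by (auto simp: fixed_regs_def first_item_def
        intro!: exI[of _ "narr s _"])
next
  case (2 k s1)
  then obtain N H where s1: "fixed_regs m n p s1" "nreg s1 5 = m - k"
      "narr s1 = (narr s)(5 := N, 6 := H)"
    and N: "\<forall>i<m. m - k \<le> i \<longrightarrow> first_item ty m (ty i) (Suc i) (N i)"
    and H: "\<forall>l\<le>p. first_item ty m l (m - k) (H l)"
    by auto
  define a where "a = m - Suc k"
  have a: "m - k = Suc a" "a < m" "ty a \<le> p"
    using 2(1) types(2)[of a] by (auto simp: a_def)
  \<comment> \<open>The old head of the type of \<open>a\<close> is the first later item of that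
    type, hence the successor of \<open>a\<close>.\<close>
  have N': "\<forall>i<m. a \<le> i \<longrightarrow> first_item ty m (ty i) (Suc i) ((N(a := H (ty a))) i)"
    using N H a by auto
  have H': "\<forall>l\<le>p. first_item ty m l a ((H(ty a := a)) l)"
    using H a by (auto simp: first_item_def) (metis Suc_leI le_neq_implies_less)+
  let ?c = "block [Sub 5 5 4, Load 6 4 5, Load 7 6 6, Store 5 5 7, Store 6 6 5]"
  have "runs ?c s1 5 (\<lambda>s'. fixed_regs m n p s' \<and> nreg s' 5 = a \<and>
      narr s' = (narr s)(5 := N(a := H (ty a)), 6 := H(ty a := a)))"
    using s1 a types by (intro runs_block) (auto simp: fixed_regs_def fun_upd_twist)
  then have "runs ?c s1 5 (\<lambda>s'. fixed_regs m n p s' \<and> Suc k \<le> m \<and> nreg s' 5 = a \<and>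
      (\<exists>N H. narr s' = (narr s)(5 := N, 6 := H) \<and>
        (\<forall>i<m. a \<le> i \<longrightarrow> first_item ty m (ty i) (Suc i) (N i)) \<and>
        (\<forall>l\<le>p. first_item ty m l a (H l))))"
    by (rule runs_mono) (use N' H' 2(1) Suc_leI in blast)+
  with s1 a show ?case
    unfolding a_def by (simp add: fixed_regs_def)
qed (auto simp: fixed_regs_def)

section \<open>Suffix minima of the bounds\<close>

lemma all_nat_split: "(\<forall>q. R q) \<longleftrightarrow> R 0 \<and> (\<forall>q. R (Suc q))"
  by (metis not0_implies_Suc)

text \<open>The machine cannot multiply, so \<open>n * p\<close> is found by repeated addition. One
  downward pass over the flat matrix then compares each entry with the one \<open>p\<close> places
  further, which belongs to the same property at the next position.\<close>

definition tighten :: program where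
  "tighten = Seq (Seq (block [Const 5 0, Const 6 0])
       (Loop (Less 5 1) (block [Add 6 6 2, Add 5 5 4])))
     (Seq (block [Sub 5 6 2]) (Loop (Less 3 5)
       (Seq (block [Sub 5 5 4, Add 6 5 2, Load 7 2 6, Load 8 2 5])
         (Cond (Less 7 8) (block [Store 2 5 7]) Skip))))"

text \<open>A suffix minimum is described by the numbers strictly below it, the form in which
  \<open>available\<close> tests for room.\<close>

lemma runs_tighten:
  assumes "fixed_regs m n p s" "0 < n"
  shows "runs tighten s (3 * n + 7 * (n * p) + 10) (\<lambda>s'. fixed_regs m n p s' \<and>
    (\<exists>A. narr s' = (narr s)(2 := A) \<and> (\<forall>k<n. \<forall>l<p. \<forall>c. c < A (k * p + l) \<longleftrightarrow>
      (\<forall>j. k \<le> j \<and> j < n \<longrightarrow> c < narr s 2 (j * p + l)))))"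
  unfolding tighten_def
proof (rule runs_Seq)
  show "runs (Seq (block [Const 5 0, Const 6 0])
       (Loop (Less 5 1) (block [Add 6 6 2, Add 5 5 4]))) s (3 * n + 3)
     (\<lambda>s'. fixed_regs m n p s' \<and> nreg s' 6 = n * p \<and> narr s' = narr s)"
    by (rule runs_for[where N = n and T = "\<lambda>_. 2" and J = "\<lambda>k s'. fixed_regs m n p s' \<and>
      nreg s' 5 = k \<and> nreg s' 6 = k * p \<and> narr s' = narr s"])
      (use assms in \<open>auto simp: fixed_regs_def intro!: runs_block\<close>)
next
  fix s0 assume s0: "fixed_regs m n p s0 \<and> nreg s0 6 = n * p \<and> narr s0 = narr s"
  define B where "B = narr s 2"
  \<comment> \<open>Entries from \<open>?a k\<close> on are finished after \<open>k\<close>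
    iterations. The last row is its own suffix minimum, so the pass starts just before it. The
    invariant forgets rows and speaks of the translates \<open>x + q * p\<close> of a flat
    index.\<close>
  let ?a = "\<lambda>k. n * p - p - k"
  show "runs (Seq (block [Sub 5 6 2]) (Loop (Less 3 5)
       (Seq (block [Sub 5 5 4, Add 6 5 2, Load 7 2 6, Load 8 2 5])
         (Cond (Less 7 8) (block [Store 2 5 7]) Skip)))) s0 (7 * (n * p) + 2) (\<lambda>s'. fixed_regs m n p s' \<and>
    (\<exists>A. narr s' = (narr s)(2 := A) \<and> (\<forall>k<n. \<forall>l<p. \<forall>c. c < A (k * p + l) \<longleftrightarrow>
      (\<forall>j. k \<le> j \<and> j < n \<longrightarrow> c < narr s 2 (j * p + l)))))"
  proof (rule runs_for[where N = "?a 0" and T = "\<lambda>_. 6" and J = "\<lambda>k s'. fixed_regs m n p s' \<and>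
      nreg s' 5 = ?a k \<and> (\<exists>A. narr s' = (narr s)(2 := A) \<and> (\<forall>x<?a k. A x = B x) \<and>
        (\<forall>x<n * p. ?a k \<le> x \<longrightarrow>
          (\<forall>c. c < A x \<longleftrightarrow> (\<forall>q. x + q * p < n * p \<longrightarrow> c < B (x + q * p)))))"], goal_cases)
    case 1
    have "q = 0" if "x + q * p < n * p" "n * p - p \<le> x" for x q
      using that by (cases q) auto
    then have base: "\<forall>x<n * p. ?a 0 \<le> x \<longrightarrow>
        (\<forall>c. c < B x \<longleftrightarrow> (\<forall>q. x + q * p < n * p \<longrightarrow> c < B (x + q * p)))"
      by (metis add.right_neutral diff_zero mult_0)
    show ?case
      by (intro conjI exI[of _ B] base) (use s0 in \<open>auto simp: fixed_regs_def B_def\<close>)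
  next
    case (2 k s1)
    then obtain A where s1: "fixed_regs m n p s1" "nreg s1 5 = ?a k" "narr s1 = (narr s)(2 := A)"
      and A: "\<forall>x<?a k. A x = B x" "\<And>x c. \<lbrakk>x < n * p; ?a k \<le> x\<rbrakk> \<Longrightarrow>
          c < A x \<longleftrightarrow> (\<forall>q. x + q * p < n * p \<longrightarrow> c < B (x + q * p))"
      by auto
    define a where "a = ?a (Suc k)"
    have a: "?a k = Suc a" "a + p < n * p" "0 < p"
      using 2(1) by (auto simp: a_def intro: gr0I)
    define A' where "A' = A(a := min (A a) (A (a + p)))"
    have "c < A' a \<longleftrightarrow> (\<forall>q. a + q * p < n * p \<longrightarrow> c < B (a + q * p))" for c
    proof -
      \<comment> \<open>The entry at \<open>a + p\<close> is finished and accounts for all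
        translates of \<open>a\<close> with positive \<open>q\<close>.\<close>
      have "c < A (a + p) \<longleftrightarrow> (\<forall>q. a + p + q * p < n * p \<longrightarrow> c < B (a + p + q * p))"
        using a by (intro A(2)) auto
      also have "\<dots> \<longleftrightarrow> (\<forall>q. a + Suc q * p < n * p \<longrightarrow> c < B (a + Suc q * p))"
        by (simp add: algebra_simps)
      finally have "c < A' a \<longleftrightarrow> c < B a \<and> (\<forall>q. a + Suc q * p < n * p \<longrightarrow> c < B (a + Suc q * p))"
        using A(1) a by (simp add: A'_def)
      also have "\<dots> \<longleftrightarrow> (\<forall>q. a + q * p < n * p \<longrightarrow> c < B (a + q * p))"
        using a all_nat_split[of "\<lambda>q. a + q * p < n * p \<longrightarrow> c < B (a + q * p)"] by simp
      finally show ?thesis .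
    qed
    moreover have "c < A' x \<longleftrightarrow> (\<forall>q. x + q * p < n * p \<longrightarrow> c < B (x + q * p))"
      if "x < n * p" "a < x" for x c
      using A(2)[of x c] a that by (simp add: A'_def)
    ultimately have A': "\<forall>x<n * p. a \<le> x \<longrightarrow>
        (\<forall>c. c < A' x \<longleftrightarrow> (\<forall>q. x + q * p < n * p \<longrightarrow> c < B (x + q * p)))"
      by (metis le_neq_implies_less)
    have A'': "\<forall>x<a. A' x = B x"
      using A(1) a by (auto simp: A'_def)
    let ?is = "[Sub 5 5 4, Add 6 5 2, Load 7 2 6, Load 8 2 5]"
    define s2 where "s2 = fold step ?is s1"
    have s2: "fixed_regs m n p s2" "nreg s2 5 = a" "nreg s2 7 = A (a + p)" "nreg s2 8 = A a"
      "narr s2 = (narr s)(2 := A)"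
      using s1 a by (auto simp: fixed_regs_def s2_def)
    have "runs (Cond (Less 7 8) (block [Store 2 5 7]) Skip) s2 2
        (\<lambda>s'. fixed_regs m n p s' \<and> nreg s' 5 = a \<and> narr s' = (narr s)(2 := A'))"
    proof (rule runs_Cond[where T = 1], goal_cases)
      case 1
      then show ?case
        using s2 by (intro runs_block) (auto simp: fixed_regs_def A'_def min_def)
    next
      case 2
      then show ?case
        using s2 by (intro runs_Skip) (auto simp: A'_def min_def fun_eq_iff)
    qed simp
    then have "runs (Seq (block ?is) (Cond (Less 7 8) (block [Store 2 5 7]) Skip)) s1 6
        (\<lambda>s'. fixed_regs m n p s' \<and> nreg s' 5 = a \<and> narr s' = (narr s)(2 := A'))"
      unfolding s2_def by (rule runs_block_Seq) simp
    then have "runs (Seq (block ?is) (Cond (Less 7 8) (block [Store 2 5 7]) Skip)) s1 6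
      (\<lambda>s'. fixed_regs m n p s' \<and> nreg s' 5 = a \<and> (\<exists>A. narr s' = (narr s)(2 := A) \<and>
        (\<forall>x<a. A x = B x) \<and> (\<forall>x<n * p. a \<le> x \<longrightarrow>
          (\<forall>c. c < A x \<longleftrightarrow> (\<forall>q. x + q * p < n * p \<longrightarrow> c < B (x + q * p))))))"
      by (rule runs_mono) (use A' A'' in blast)+
    with s1 a show ?case
      unfolding a_def by (simp add: fixed_regs_def)
  next
    case (3 s1)
    then obtain A where s1: "narr s1 = (narr s)(2 := A)"
      and A: "\<And>x c. x < n * p \<Longrightarrow> c < A x \<longleftrightarrow> (\<forall>q. x + q * p < n * p \<longrightarrow> c < B (x + q * p))"
      by auto
    \<comment> \<open>Back from flat indices to pairs: a translate stays inside the matrix exactly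
      when its row does.\<close>
    have index: "k * p + l < n * p \<longleftrightarrow> k < n" if "l < p" for k l
    proof
      assume "k < n"
      then have "Suc k * p \<le> n * p" by (intro mult_le_mono1) simp
      with that show "k * p + l < n * p" by simp
    next
      assume "k * p + l < n * p"
      then have "k * p < n * p" by (rule add_lessD1)
      then show "k < n" by simp
    qed
    have "c < A (k * p + l) \<longleftrightarrow> (\<forall>j. k \<le> j \<and> j < n \<longrightarrow> c < B (j * p + l))" if "k < n" "l < p" for k l c
    proof -
      have "c < A (k * p + l) \<longleftrightarrow> (\<forall>q. (k + q) * p + l < n * p \<longrightarrow> c < B ((k + q) * p + l))"
        using A[of "k * p + l" c] index that by (simp add: algebra_simps)
      also have "\<dots> \<longleftrightarrow> (\<forall>q. k + q < n \<longrightarrow> c < B ((k + q) * p + l))"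
        using index that by simp
      also have "\<dots> \<longleftrightarrow> (\<forall>j. k \<le> j \<and> j < n \<longrightarrow> c < B (j * p + l))"
        by (auto dest!: le_Suc_ex)
      finally show ?thesis .
    qed
    with 3 s1 show ?case by (auto simp: fixed_regs_def B_def)
  next
    case 4
    then show ?case by simp
  qed
qed simp

section \<open>Selecting the items position by position\<close>

definition scan :: program where
  "scan = Seq (block [Load 7 6 2, Const 8 0]) (Loop (Less 8 2)
     (Seq (block [Load 9 6 8, Load 10 7 8, Load 11 2 6])
       (Seq (Cond (Less 9 7) (Cond (Less 10 11) (block [Add 7 9 3]) Skip) Skip)
         (block [Add 8 8 4, Add 6 6 4]))))"

text \<open>The head \<open>H p\<close> always takes part, since items without property are
  unconstrained; it is also the start value of the scan.\<close>

definition best_head :: "nat \<Rightarrow> (nat \<Rightarrow> nat) \<Rightarrow> (nat \<Rightarrow> bool) \<Rightarrow> nat \<Rightarrow> nat \<Rightarrow> bool" where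
  "best_head p H R k b \<longleftrightarrow> b \<le> H p \<and> (\<forall>l<k. R l \<longrightarrow> b \<le> H l) \<and>
     (b = H p \<or> (\<exists>l<k. R l \<and> b = H l))"

lemma best_head_Suc:
  assumes "best_head p H R k b"
  shows "best_head p H R (Suc k) (if R k \<and> H k < b then H k else b)"
  using assms unfolding best_head_def by (auto simp: less_Suc_eq)

text \<open>Register 6 advances by \<open>p\<close> and so ends at the next row of bounds; no row
  offset has to be multiplied out.\<close>

lemma runs_scan:
  assumes "fixed_regs m n p s"
  shows "runs scan s (9 * p + 3) (\<lambda>s'. fixed_regs m n p s' \<and> nreg s' 5 = nreg s 5 \<and>
    nreg s' 6 = nreg s 6 + p \<and> narr s' = narr s \<and>
    best_head p (narr s 6) (\<lambda>l. narr s 7 l < narr s 2 (nreg s 6 + l)) p (nreg s' 7))"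
proof -
  define R where "R = (\<lambda>l. narr s 7 l < narr s 2 (nreg s 6 + l))"
  let ?J = "\<lambda>k s'. fixed_regs m n p s' \<and> nreg s' 5 = nreg s 5 \<and> nreg s' 8 = k \<and>
    nreg s' 6 = nreg s 6 + k \<and> narr s' = narr s \<and> best_head p (narr s 6) R k (nreg s' 7)"
  have "runs scan s (9 * p + 3) (?J p)"
    unfolding scan_def
  proof (rule runs_for[where N = p and T = "\<lambda>_. 8" and J = ?J], goal_cases)
    case 1
    then show ?case
      using assms by (auto simp: fixed_regs_def best_head_def)
  next
    case (2 k s1)
    define s2 where "s2 = fold step [Load 9 6 8, Load 10 7 8, Load 11 2 6] s1"
    let ?b = "if R k \<and> narr s 6 k < nreg s1 7 then narr s 6 k else nreg s1 7"
    have s2: "fixed_regs m n p s2" "nreg s2 5 = nreg s 5" "nreg s2 8 = k"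
        "nreg s2 6 = nreg s 6 + k" "narr s2 = narr s" "nreg s2 7 = nreg s1 7"
        "nreg s2 9 = narr s 6 k" "nreg s2 10 < nreg s2 11 \<longleftrightarrow> R k"
      using 2 by (auto simp: fixed_regs_def s2_def R_def)
    have b: "best_head p (narr s 6) R (Suc k) ?b"
      using 2 by (intro best_head_Suc) auto
    have "runs (Cond (Less 9 7) (Cond (Less 10 11) (block [Add 7 9 3]) Skip) Skip) s2 3
      (\<lambda>s'. fixed_regs m n p s' \<and> nreg s' 5 = nreg s 5 \<and> nreg s' 8 = k \<and>
        nreg s' 6 = nreg s 6 + k \<and> narr s' = narr s \<and> nreg s' 7 = ?b)"
      using s2
      by (intro runs_Cond[where T = 2] runs_Cond[where T = 1] runs_block runs_Skip)
        (auto simp: fixed_regs_def)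
    then have "runs (Seq (Cond (Less 9 7) (Cond (Less 10 11) (block [Add 7 9 3]) Skip) Skip)
        (block [Add 8 8 4, Add 6 6 4])) s2 5 (?J (Suc k))"
      by (rule runs_Seq[where T' = 2])
        (use b in \<open>auto simp: fixed_regs_def intro!: runs_block simp del: if_split\<close>)
    with 2 show ?case
      unfolding s2_def by (intro conjI runs_block_Seq) (auto simp: fixed_regs_def)
  qed (auto simp: fixed_regs_def)
  then show ?thesis
    by (rule runs_mono) (auto simp: R_def)
qed

definition select :: program where
  "select = Seq (block [Const 5 0, Const 6 0]) (Loop (Less 5 1) (Seq scan
     (block [Store 3 5 7, Load 9 4 7, Load 10 5 7, Store 6 9 10,
             Load 11 7 9, Add 11 11 4, Store 7 9 11, Add 5 5 4])))"

context typed_ranking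
begin

text \<open>Items leave their sorted list only at its head, so the used items of a type are exactly
  those before the current head.\<close>

definition progress :: "(nat \<Rightarrow> nat) \<Rightarrow> nat \<Rightarrow> (nat \<Rightarrow> nat) \<Rightarrow> (nat \<Rightarrow> nat) \<Rightarrow> bool" where
  "progress g k H C \<longleftrightarrow> greedy g k \<and> (\<forall>l\<le>p. H l \<le> m \<and> (H l < m \<longrightarrow> ty (H l) = l)) \<and>
     (\<forall>i<m. i \<in> g ` {..<k} \<longleftrightarrow> i < H (ty i)) \<and> (\<forall>l\<le>p. C l = count g k l)"

lemma progress_Suc:
  assumes "progress g k H C" "k < n" "admissible f"
    and types: "\<And>i. i < m \<Longrightarrow> ty i \<le> p"
    and N: "\<And>i. i < m \<Longrightarrow> first_item ty m (ty i) (Suc i) (N i)"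
    and R: "\<And>l. l < p \<Longrightarrow> R l \<longleftrightarrow> (\<forall>j. k \<le> j \<and> j < n \<longrightarrow> C l < U j l)"
    and b: "best_head p H R p b"
  shows "progress (g(k := b)) (Suc k) (H(ty b := N b)) (C(ty b := C (ty b) + 1))"
proof -
  have g: "greedy g k" and H: "\<And>l. l \<le> p \<Longrightarrow> H l \<le> m" "\<And>l. \<lbrakk>l \<le> p; H l < m\<rbrakk> \<Longrightarrow> ty (H l) = l"
    and used: "\<And>i. i < m \<Longrightarrow> i \<in> g ` {..<k} \<longleftrightarrow> i < H (ty i)"
    and C: "\<And>l. l \<le> p \<Longrightarrow> C l = count g k l"
    using assms(1) by (auto simp: progress_def)
  have avail: "available g k i \<longleftrightarrow> i < m \<and> H (ty i) \<le> i \<and> (ty i < p \<longrightarrow> R (ty i))" for i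
    using used[of i] C[of "ty i"] R[of "ty i"] by (auto simp: available_def)
  have least: "b \<le> i" if "available g k i" for i
  proof -
    have "b \<le> H (ty i)"
      using that b types[of i] by (cases "ty i = p") (auto simp: avail best_head_def)
    then show ?thesis using that by (simp add: avail)
  qed
  \<comment> \<open>Some item is available, and \<open>b\<close> is at most that item; so
    \<open>b\<close> is a genuine item and not the end marker \<open>m\<close>.\<close>
  obtain i where "available g k i"
    using greedy_continues[OF g \<open>k < n\<close> \<open>admissible f\<close>] ..
  with least[of i] have "b < m"
    by (simp add: avail)
  have b_head: "b = H (ty b)" "ty b < p \<longrightarrow> R (ty b)"
    using b \<open>b < m\<close> H(2) by (auto simp: best_head_def)
  with \<open>b < m\<close> have "available g k b"
    by (simp add: avail)
  moreover have "greedy (g(k := b)) k"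
    using g greedy_cong[of k "g(k := b)" g] by simp
  ultimately have "greedy (g(k := b)) (Suc k)"
    using least available_cong[of k "g(k := b)" g] by (auto simp: greedy_def less_Suc_eq)
  moreover have "(H(ty b := N b)) l \<le> m \<and> ((H(ty b := N b)) l < m \<longrightarrow> ty ((H(ty b := N b)) l) = l)"
    if "l \<le> p" for l
    using H that N[OF \<open>b < m\<close>] by (auto simp: first_item_def)
  moreover have "i \<in> (g(k := b)) ` {..<Suc k} \<longleftrightarrow> i < (H(ty b := N b)) (ty i)" if "i < m" for i
  proof -
    have "i \<in> (g(k := b)) ` {..<Suc k} \<longleftrightarrow> i = b \<or> i \<in> g ` {..<k}"
      by (auto simp: lessThan_Suc)
    also have "\<dots> \<longleftrightarrow> i = b \<or> i < H (ty i)"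
      using used that by simp
    also have "\<dots> \<longleftrightarrow> i < (H(ty b := N b)) (ty i)"
    proof (cases "ty i = ty b")
      case True
      \<comment> \<open>No item of this type lies strictly between \<open>b\<close> and
        \<open>N b\<close>.\<close>
      have "i < N b \<longleftrightarrow> i \<le> b"
        using N[OF \<open>b < m\<close>] True by (cases "i \<le> b") (auto simp: first_item_def)
      with True b_head(1) show ?thesis by auto
    next
      case False
      then show ?thesis by auto
    qed
    finally show ?thesis .
  qed
  moreover have "(C(ty b := C (ty b) + 1)) l = count (g(k := b)) (Suc k) l" if "l \<le> p" for l
    using C[OF that] count_cong[of k "g(k := b)" g l] by (auto simp: count_Suc)
  ultimately show ?thesis
    unfolding progress_def by blast
qed

text \<open>The time bound is unconditional. Without an admissible ranking the scan may return
  \<open>m\<close> and arbitrary memory is read, so \<open>progress\<close> is claimed only if one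
  exists.\<close>

lemma runs_select:
  assumes "fixed_regs m n p s" and types: "narr s 4 = ty" "\<And>i. i < m \<Longrightarrow> ty i \<le> p"
    and N: "\<And>i. i < m \<Longrightarrow> first_item ty m (ty i) (Suc i) (narr s 5 i)"
    and heads: "\<And>l. l \<le> p \<Longrightarrow> first_item ty m l 0 (narr s 6 l)"
    and counts: "\<And>l. l \<le> p \<Longrightarrow> narr s 7 l = 0"
    and bounds: "\<And>k l c. \<lbrakk>k < n; l < p\<rbrakk> \<Longrightarrow>
      c < narr s 2 (k * p + l) \<longleftrightarrow> (\<forall>j. k \<le> j \<and> j < n \<longrightarrow> c < U j l)"
  shows "runs select s (9 * (n * p) + 12 * n + 3)
    (\<lambda>s'. (\<exists>f. admissible f) \<longrightarrow> greedy (narr s' 3) n)"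
  unfolding select_def
proof (rule runs_for[where N = n and T = "\<lambda>_. 9 * p + 11" and J = "\<lambda>k s'. fixed_regs m n p s' \<and>
    nreg s' 5 = k \<and> nreg s' 6 = k * p \<and> (\<exists>g H C. narr s' = (narr s)(3 := g, 6 := H, 7 := C) \<and>
      ((\<exists>f. admissible f) \<longrightarrow> progress g k H C))"], goal_cases)
  case 1
  \<comment> \<open>The initial contents of array 3 are arbitrary, and an empty greedy prefix
    permits this.\<close>
  have "progress (narr s 3) 0 (narr s 6) (narr s 7)"
    using heads counts types(2) by (auto simp: progress_def greedy_def first_item_def)
  then show ?case
    using assms(1) by (auto simp: fixed_regs_def intro!: exI[of _ "narr s _"])
next
  case (2 k s1)
  then obtain g H C where s1: "fixed_regs m n p s1" "nreg s1 5 = k" "nreg s1 6 = k * p"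
      "narr s1 = (narr s)(3 := g, 6 := H, 7 := C)"
    and prog: "(\<exists>f. admissible f) \<Longrightarrow> progress g k H C"
    by auto
  let ?R = "\<lambda>l. C l < narr s 2 (k * p + l)"
  let ?c = "block [Store 3 5 7, Load 9 4 7, Load 10 5 7, Store 6 9 10,
             Load 11 7 9, Add 11 11 4, Store 7 9 11, Add 5 5 4]"
  have "runs scan s1 (9 * p + 3) (\<lambda>s'. fixed_regs m n p s' \<and> nreg s' 5 = k \<and>
      nreg s' 6 = Suc k * p \<and> narr s' = (narr s)(3 := g, 6 := H, 7 := C) \<and>
      best_head p H ?R p (nreg s' 7))"
    by (rule runs_mono[OF runs_scan[OF s1(1)]]) (use s1 in auto)
  then have "runs (Seq scan ?c) s1 (9 * p + 11) (\<lambda>s'. fixed_regs m n p s' \<and>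
    nreg s' 5 = Suc k \<and> nreg s' 6 = Suc k * p \<and>
    (\<exists>g H C. narr s' = (narr s)(3 := g, 6 := H, 7 := C) \<and>
      ((\<exists>f. admissible f) \<longrightarrow> progress g (Suc k) H C)))"
  proof (rule runs_Seq[where T' = 8])
    fix s2
    assume s2: "fixed_regs m n p s2 \<and> nreg s2 5 = k \<and>
      nreg s2 6 = Suc k * p \<and> narr s2 = (narr s)(3 := g, 6 := H, 7 := C) \<and>
      best_head p H ?R p (nreg s2 7)"
    define b where "b = nreg s2 7"
    have prog': "progress (g(k := b)) (Suc k) (H(ty b := narr s 5 b)) (C(ty b := C (ty b) + 1))"
      if "\<exists>f. admissible f"
    proof -
      from that obtain f where "admissible f" ..
      with prog[OF that] \<open>k < n\<close> show ?thesis
        by (rule progress_Suc[where R = ?R])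
          (use s2 types(2) N bounds \<open>k < n\<close> in \<open>auto simp: b_def\<close>)
    qed
    have "runs ?c s2 8 (\<lambda>s'. fixed_regs m n p s' \<and> nreg s' 5 = Suc k \<and>
      nreg s' 6 = Suc k * p \<and> narr s' = (narr s)(3 := g(k := b), 6 := H(ty b := narr s 5 b),
        7 := C(ty b := C (ty b) + 1)))"
      using s2 types(1)
      by (intro runs_block) (auto simp: fixed_regs_def b_def fun_upd_twist)
    then show "runs ?c s2 8 (\<lambda>s'. fixed_regs m n p s' \<and> nreg s' 5 = Suc k \<and>
      nreg s' 6 = Suc k * p \<and> (\<exists>g H C. narr s' = (narr s)(3 := g, 6 := H, 7 := C) \<and>
        ((\<exists>f. admissible f) \<longrightarrow> progress g (Suc k) H C)))"
      by (rule runs_mono) (use prog' in blast)+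
  qed simp
  with s1 2(1) show ?case
    by (simp add: fixed_regs_def)
next
  case (3 s1)
  then show ?case
    by (auto simp: fixed_regs_def progress_def)
next
  case 4
  then show ?case by (simp add: algebra_simps)
qed

end


section \<open>Ranking matrices\<close>

lemma sum_nat_eq_1_indicator:
  fixes h :: "'a \<Rightarrow> nat"
  assumes "finite A" "sum h A = 1"
  shows "\<exists>i\<in>A. \<forall>i'\<in>A. h i' = (if i = i' then 1 else 0)"
proof -
  obtain i where "i \<in> A" "h i = 1" "\<forall>i'\<in>A. i \<noteq> i' \<longrightarrow> h i' = 0"
    using sum_eq_1_iff[OF assms(1), of h] assms(2) by blast
  then show ?thesis by (intro bexI[of _ i]) auto
qed

text \<open>For an item without property this only forces the type to be at least
  \<open>properties I\<close>.\<close>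

locale typed_instance =
  fixes I :: ranking_instance and ty :: "nat \<Rightarrow> nat"
  assumes wf: "well_formed I" and mono: "monotone_weights I" and monge: "monge I"
    and ty: "\<And>i l. \<lbrakk>i < items I; l < properties I\<rbrakk> \<Longrightarrow> ty i = l \<longleftrightarrow> i \<in> property I l"
begin

sublocale typed_ranking "items I" "positions I" "properties I" "weight I" ty "ubound I"
  by unfold_locales (use mono monge in \<open>auto simp: monotone_weights_def monge_def\<close>)

definition matrix :: "(nat \<Rightarrow> nat) \<Rightarrow> nat \<Rightarrow> nat \<Rightarrow> nat" where
  "matrix f i j = (if f j = i then 1 else 0)"

lemma matrix_01: "matrix f i j = 0 \<or> matrix f i j = Suc 0"
  by (simp add: matrix_def)

lemma property_count:
  assumes "\<forall>j<positions I. f j < items I" "l < properties I" "k < positions I"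
  shows "(\<Sum>j\<le>k. \<Sum>i\<in>property I l. matrix f i j) = count f (Suc k) l"
proof -
  have fin: "finite (property I l)"
    using wf assms(2) by (auto simp: well_formed_def intro: finite_subset[OF _ finite_lessThan])
  have "(\<Sum>j\<le>k. \<Sum>i\<in>property I l. matrix f i j) = (\<Sum>j\<le>k. if ty (f j) = l then 1 else 0)"
    using assms ty fin by (intro sum.cong) (auto simp: matrix_def sum.delta)
  also have "\<dots> = card {j \<in> {..k}. ty (f j) = l}"
    by (simp add: sum.If_cases Int_def)
  also have "{j \<in> {..k}. ty (f j) = l} = {j. j < Suc k \<and> ty (f j) = l}"
    by auto
  finally show ?thesis by (simp add: count_def)
qed

text \<open>Column sums are 1 because \<open>f\<close> is a function into the items; row sums at
  most 1 express injectivity.\<close>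

lemma feasible_matrix_iff:
  assumes "\<forall>j<positions I. f j < items I"
  shows "feasible I (matrix f) \<longleftrightarrow> admissible f"
proof -
  have "(\<Sum>i<items I. matrix f i j) = 1" if "j < positions I" for j
    using assms that by (simp add: matrix_def)
  moreover have "(\<forall>i<items I. (\<Sum>j<positions I. matrix f i j) \<le> 1) \<longleftrightarrow> inj_on f {..<positions I}"
  proof -
    have "(\<Sum>j<positions I. matrix f i j) = card {j \<in> {..<positions I}. f j = i}" for i
      by (simp add: matrix_def sum.If_cases Int_def)
    moreover have "(\<forall>i<items I. card {j \<in> {..<positions I}. f j = i} \<le> Suc 0) \<longleftrightarrow>
        inj_on f {..<positions I}"
      using assms by (auto simp: card_le_Suc0_iff_eq inj_on_def)
    ultimately show ?thesis by simp
  qed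
  ultimately show ?thesis
    using assms property_count[OF assms]
    by (auto simp: feasible_def is_ranking_def admissible_def matrix_01)
qed

lemma objective_matrix:
  assumes "\<forall>j<positions I. f j < items I"
  shows "objective I (matrix f) = profit f"
proof -
  have "objective I (matrix f) =
      (\<Sum>j<positions I. \<Sum>i<items I. weight I i j * real (matrix f i j))"
    unfolding objective_def by (rule sum.swap)
  also have "\<dots> = (\<Sum>j<positions I. \<Sum>i<items I. if f j = i then weight I i j else 0)"
    by (intro sum.cong) (auto simp: matrix_def)
  also have "\<dots> = profit f"
    using assms by (simp add: profit_def)
  finally show ?thesis .
qed

text \<open>Each column contains a single 1, whose row defines \<open>f\<close>. As \<open>x\<close>
  is unknown outside the index range, feasibility and objective are transferred instead of an
  equality of matrices.\<close>

lemma feasible_obtains: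
  assumes "feasible I x"
  obtains f where "admissible f" "objective I x = profit f"
proof -
  have "\<exists>i\<in>{..<items I}. \<forall>i'\<in>{..<items I}. x i' j = (if i = i' then 1 else 0)"
    if "j < positions I" for j
    using assms that by (intro sum_nat_eq_1_indicator) (auto simp: feasible_def is_ranking_def)
  then obtain f where f: "\<forall>j<positions I. f j < items I"
    and x: "\<And>i j. \<lbrakk>i < items I; j < positions I\<rbrakk> \<Longrightarrow> x i j = matrix f i j"
    unfolding matrix_def by (metis lessThan_iff)
  have "(\<Sum>j\<le>k. \<Sum>i\<in>property I l. x i j) = (\<Sum>j\<le>k. \<Sum>i\<in>property I l. matrix f i j)"
    if "l < properties I" "k < positions I" for k l
    using that wf by (intro sum.cong refl x) (auto simp: well_formed_def)
  then have "feasible I x \<longleftrightarrow> feasible I (matrix f)"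
    by (simp add: feasible_def is_ranking_def x)
  moreover have "objective I x = objective I (matrix f)"
    by (simp add: objective_def x)
  ultimately show ?thesis
    using that assms feasible_matrix_iff[OF f] objective_matrix[OF f] by simp
qed

lemma greedy_optimal_matrix:
  assumes "greedy g (positions I)" "feasible I x"
  shows "optimal I (matrix g)"
proof -
  have g: "\<forall>j<positions I. g j < items I"
    using assms(1) by (auto simp: greedy_def available_def)
  have "feasible I (matrix g)"
    using assms greedy_optimal(1) feasible_matrix_iff[OF g] by (metis feasible_obtains)
  moreover have "objective I y \<le> objective I (matrix g)" if "feasible I y" for y
    using that greedy_optimal(2)[OF assms(1)] objective_matrix[OF g] by (metis feasible_obtains)
  ultimately show ?thesis by (simp add: optimal_def)
qed

end

section \<open>The complete algorithm and its running time\<close>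

definition ranking_program :: program where
  "ranking_program = Seq (block [Const 3 0, Const 4 1]) (Cond (Less 3 1)
     (Seq clear_types (Seq mark_types (Seq init_heads (Seq link (Seq tighten select))))) Skip)"

text \<open>The program first tests for \<open>n = 0\<close>: the preparation takes time
  proportional to \<open>p\<close>, which \<open>m + n * p\<close> does not bound in that
  case.\<close>

lemma runs_ranking_program:
  assumes wf: "well_formed I" and one: "at_most_one_property I"
    and mono: "monotone_weights I" and monge: "monge I" and enc: "encodes s I"
  shows "runs ranking_program s (30 * (items I + positions I * properties I + 1))
    (\<lambda>s'. (\<exists>x. feasible I x) \<longrightarrow> optimal I (output_ranking s'))"
    (is "runs _ _ _ ?Q")
proof -
  define m n p where "m = items I" and "n = positions I" and "p = properties I"
  note mnp = m_def n_def p_def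
  define s0 where "s0 = fold step [Const 3 0, Const 4 1] s"
  have s0: "fixed_regs m n p s0" "narr s0 = narr s"
    using enc by (auto simp: s0_def fixed_regs_def encodes_def mnp)
  have disjoint: "property I l \<inter> property I l' = {}" if "l < p" "l' < p" "l \<noteq> l'" for l l'
  proof (rule ccontr)
    assume "property I l \<inter> property I l' \<noteq> {}"
    then obtain i where i: "i \<in> property I l" "i \<in> property I l'" by auto
    with wf that have "i < items I" by (auto simp: well_formed_def p_def)
    with one have "card {l. l < p \<and> i \<in> property I l} \<le> Suc 0"
      by (simp add: at_most_one_property_def p_def)
    with i that show False by (auto simp: card_le_Suc0_iff_eq)
  qed
  have members: "narr s 1 ` {narr s 0 l..<narr s 0 (Suc l)} = property I l" if "l < p" for l
    by (rule bij_betw_imp_surj_on) (use enc that in \<open>unfold encodes_def p_def, blast\<close>)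
  have main: "runs
      (Seq clear_types (Seq mark_types (Seq init_heads (Seq link (Seq tighten select)))))
      s0 (13 * m + 16 * (n * p) + 15 * n + 9 * p + 27) ?Q" if "0 < n"
  proof (rule runs_Seq[OF runs_clear_types[OF s0(1)]], elim conjE exE)
    fix s1 A1
    assume s1: "fixed_regs m n p s1" "narr s1 = (narr s0)(4 := A1)" "\<forall>i<m. A1 i = p"
    have mark: "runs mark_types s1 (4 * m + 5 * p + 3)
      (\<lambda>s'. fixed_regs m n p s' \<and> (\<exists>A. narr s' = (narr s1)(4 := A) \<and>
        (\<forall>i<m. A i \<le> p \<and> (\<forall>l<p. A i = l \<longleftrightarrow> i \<in> property I l))))"
      using s1 s0(2) enc wf disjoint members
      by (intro runs_mark_types) (simp_all add: encodes_def well_formed_def mnp)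
    show "runs (Seq mark_types (Seq init_heads (Seq link (Seq tighten select)))) s1
      (10 * m + 16 * (n * p) + 15 * n + 9 * p + 25) ?Q"
    proof (rule runs_Seq[OF mark], elim conjE exE)
      fix s2 ty
      assume s2: "fixed_regs m n p s2" "narr s2 = (narr s1)(4 := ty)"
        and types: "\<forall>i<m. ty i \<le> p \<and> (\<forall>l<p. ty i = l \<longleftrightarrow> i \<in> property I l)"
      \<comment> \<open>The computed array itself serves as the type function; its contents beyond
        the items are arbitrary.\<close>
      interpret typed_instance I ty
        by unfold_locales (use wf mono monge types in \<open>auto simp: mnp\<close>)
      show "runs (Seq init_heads (Seq link (Seq tighten select))) s2
        (6 * m + 16 * (n * p) + 15 * n + 4 * p + 22) ?Q"
      proof (rule runs_Seq[OF runs_init_heads[OF s2(1)]], elim conjE exE)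
        fix s3 H3 C
        assume s3: "fixed_regs m n p s3" "narr s3 = (narr s2)(6 := H3, 7 := C)"
          and init: "\<forall>l\<le>p. H3 l = m \<and> C l = 0"
        have link: "runs link s3 (6 * m + 2) (\<lambda>s'. fixed_regs m n p s' \<and>
          (\<exists>N H. narr s' = (narr s3)(5 := N, 6 := H) \<and>
            (\<forall>i<m. first_item ty m (ty i) (Suc i) (N i)) \<and>
            (\<forall>l\<le>p. first_item ty m l 0 (H l))))"
          using s3 s2(2) types init by (intro runs_link) auto
        show "runs (Seq link (Seq tighten select)) s3 (6 * m + 16 * (n * p) + 15 * n + 15) ?Q"
        proof (rule runs_Seq[OF link], elim conjE exE)
          fix s4 N H
          assume s4: "fixed_regs m n p s4" "narr s4 = (narr s3)(5 := N, 6 := H)"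
            and NH: "\<forall>i<m. first_item ty m (ty i) (Suc i) (N i)"
              "\<forall>l\<le>p. first_item ty m l 0 (H l)"
          show "runs (Seq tighten select) s4 (16 * (n * p) + 15 * n + 13) ?Q"
          proof (rule runs_Seq[OF runs_tighten[OF s4(1) that]], elim conjE exE)
            fix s5 A
            assume s5: "fixed_regs m n p s5" "narr s5 = (narr s4)(2 := A)"
              and A: "\<forall>k<n. \<forall>l<p. \<forall>c. c < A (k * p + l) \<longleftrightarrow>
                (\<forall>j. k \<le> j \<and> j < n \<longrightarrow> c < narr s4 2 (j * p + l))"
            have "narr s4 2 (j * p + l) = ubound I j l" if "j < n" "l < p" for j l
              using enc that s4 s3 s2 s1 s0 by (simp add: encodes_def mnp)
            with A have A': "c < A (k * p + l) \<longleftrightarrow> (\<forall>j. k \<le> j \<and> j < n \<longrightarrow> c < ubound I j l)"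
              if "k < n" "l < p" for k l c
              using that by auto
            have "runs select s5 (9 * (n * p) + 12 * n + 3)
              (\<lambda>s'. (\<exists>f. admissible f) \<longrightarrow> greedy (narr s' 3) n)"
              using runs_select[of s5] s5 s4(2) s3(2) s2(2) types NH init A' by (simp add: mnp)
            then show "runs select s5 (9 * (n * p) + 12 * n + 3) ?Q"
            proof (rule runs_mono[OF _ order.refl], intro impI, elim exE)
              fix s6 :: state and x
              assume "(\<exists>f. admissible f) \<longrightarrow> greedy (narr s6 3) n" "feasible I x"
              then have "optimal I (matrix (narr s6 3))"
                using greedy_optimal_matrix feasible_obtains unfolding n_def by metis
              moreover have "matrix (narr s6 3) = output_ranking s6"
                by (simp add: matrix_def output_ranking_def fun_eq_iff)
              ultimately show "optimal I (output_ranking s6)" by simp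
            qed
          qed simp
        qed simp
      qed simp
    qed simp
  qed simp
  \<comment> \<open>The term in \<open>n\<close> is absorbed by \<open>n \<le> m\<close>, and the
    term in \<open>p\<close> by \<open>p \<le> n * p\<close>, which holds for positive
    \<open>n\<close>.\<close>
  have cost: "13 * m + 16 * (n * p) + 15 * n + 9 * p + 30 \<le> 30 * (m + n * p + 1)" if "0 < n"
  proof -
    have "n \<le> m" using wf by (simp add: well_formed_def mnp)
    moreover have "n * p = p + (n - 1) * p"
      using that by (cases n) auto
    ultimately show ?thesis by simp
  qed
  \<comment> \<open>Without positions every objective value is 0, and feasibility does not depend on
    the matrix entries.\<close>
  have empty: "optimal I (output_ranking s')" if "n = 0" "feasible I x" for s' x
    using that by (auto simp: optimal_def feasible_def is_ranking_def objective_def n_def)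
  show ?thesis
    unfolding ranking_program_def
  proof (rule runs_block_Seq[where T = "30 * (m + n * p + 1) - 2"], fold s0_def)
    show "runs (Cond (Less 3 1)
        (Seq clear_types (Seq mark_types (Seq init_heads (Seq link (Seq tighten select))))) Skip)
        s0 (30 * (m + n * p + 1) - 2) ?Q"
    proof (rule runs_Cond[where T = "30 * (m + n * p + 1) - 3"])
      assume "holds (Less 3 1) s0"
      then have "0 < n" using s0(1) by (simp add: fixed_regs_def)
      from main[OF this] show "runs (Seq clear_types (Seq mark_types (Seq init_heads
          (Seq link (Seq tighten select))))) s0 (30 * (m + n * p + 1) - 3) ?Q"
        by (rule runs_mono) (use cost[OF \<open>0 < n\<close>] in auto)
    next
      assume "\<not> holds (Less 3 1) s0"
      then have "n = 0" using s0(1) by (simp add: fixed_regs_def)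
      then show "runs Skip s0 (30 * (m + n * p + 1) - 3) ?Q"
        using empty by (intro runs_Skip) auto
    qed simp
  qed (simp add: mnp)
qed

text \<open>The summand 1 in the bound pays for the constant work done when \<open>m\<close> and
  \<open>n * p\<close> are both zero.\<close>

theorem theorem8:
  "\<exists>(alg :: program) (c :: nat). \<forall>(I :: ranking_instance) (s :: state).
     well_formed I \<and> at_most_one_property I \<and> monotone_weights I \<and> monge I \<and> encodes s I \<longrightarrow>
     (\<exists>t s'. exec alg s t s' \<and>
             t \<le> c * (items I + positions I * properties I + 1) \<and>
             ((\<exists>x. feasible I x) \<longrightarrow> optimal I (output_ranking s')))"
  using runs_ranking_program unfolding runs_def by blast

end
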